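(* Let $\Gamma$ be a locally compact abelian group and let $S\subseteq\Gamma$ be nonempty with $\chi_S\in\mathrm{B}(\Gamma)$. If $1<\|\chi_S\|_{\mathrm{B}(\Gamma)}<\frac{4}{3}$, then $S$ is the union of two cosets of some open subgroup of $\Gamma$, but $S$ is not itself a coset. Equivalently: if $G$ is a locally compact abelian group and $\mu\in\mathrm{M}(G)$ is an idempotent measure ($\mu*\mu=\mu$) with $1<\|\mu\|<\frac43$, then $d\mu(x)=[(-x,\gamma_1)+(-x,\gamma_2)]\,dm(x)$, where $m$ is the normalized Haar measure of some compact subgroup $H$ of $G$ and $\gamma_1,\gamma_2$ are distinct continuous characters of $H$.
   Context: $\mathrm{B}(\Gamma)$ is the Fourier–Stieltjes algebra of $\Gamma$ with its usual norm; for abelian $\Gamma$ with Pontryagin dual $G$, $\mathrm{B}(\Gamma)$ is isometrically isomorphic to the measure algebra $\mathrm{M}(G)$ (total variation norm) via the Fourier–Stieltjes transform; $(x,\gamma)$ denotes the pairing of $x\in G$ with a character $\gamma$. An idempotent of $\mathrm{B}(\Gamma)$ is an indicator function $\chi_S$. *)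

theory Defs
  imports "HOL-Analysis.Analysis"
begin

definition is_subgroup :: "'g::ab_group_add set \<Rightarrow> bool" where
  "is_subgroup H \<longleftrightarrow> 0 \<in> H \<and> (\<forall>x\<in>H. \<forall>y\<in>H. x - y \<in> H)"

definition coset :: "'g::ab_group_add \<Rightarrow> 'g set \<Rightarrow> 'g set" where
  "coset a H = (\<lambda>h. a + h) ` H"

definition is_haar_measure :: "'g::topological_ab_group_add measure \<Rightarrow> bool" where
  "is_haar_measure M \<longleftrightarrow>
     sets M = sets borel \<and> space M = UNIV \<and>
     (\<forall>a. \<forall>A\<in>sets borel. emeasure M ((\<lambda>x. a + x) ` A) = emeasure M A) \<and>
     (\<forall>K. compact K \<longrightarrow> emeasure M K < \<infinity>) \<and>
     (\<forall>U. open U \<longrightarrow> U \<noteq> {} \<longrightarrow> emeasure M U > 0) \<and>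
     (\<forall>A\<in>sets borel. emeasure M A = (INF U\<in>{U. open U \<and> A \<subseteq> U}. emeasure M U)) \<and>
     (\<forall>U. open U \<longrightarrow> emeasure M U = (SUP K\<in>{K. compact K \<and> K \<subseteq> U}. emeasure M K))"

definition is_character :: "('g::topological_ab_group_add \<Rightarrow> complex) \<Rightarrow> bool" where
  "is_character \<gamma> \<longleftrightarrow> continuous_on UNIV \<gamma> \<and> (\<forall>x. cmod (\<gamma> x) = 1) \<and>
     (\<forall>x y. \<gamma> (x + y) = \<gamma> x * \<gamma> y)"

text \<open>Fourier transform of an L1 function, and the C*-norm of L1 (abelian case:
  supremum of the Fourier transform over all continuous characters).\<close>
definition fourier :: "'g::topological_ab_group_add measure \<Rightarrow> ('g \<Rightarrow> complex) \<Rightarrow> ('g \<Rightarrow> complex) \<Rightarrow> complex" where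
  "fourier M g \<gamma> = integral\<^sup>L M (\<lambda>x. g x * cnj (\<gamma> x))"

definition cstar_norm :: "'g::topological_ab_group_add measure \<Rightarrow> ('g \<Rightarrow> complex) \<Rightarrow> real" where
  "cstar_norm M g = (SUP \<gamma>\<in>{\<gamma>. is_character \<gamma>}. cmod (fourier M g \<gamma>))"

text \<open>Fourier--Stieltjes algebra B(Gamma) via the Eberlein/Eymard description:
  bounded continuous f whose pairing with L1 is bounded by the C*-norm;
  the B-norm is the norm of that functional on C*(Gamma).\<close>
definition in_B :: "'g::topological_ab_group_add measure \<Rightarrow> ('g \<Rightarrow> complex) \<Rightarrow> bool" where
  "in_B M f \<longleftrightarrow> continuous_on UNIV f \<and> bounded (range f) \<and>
     (\<exists>C. \<forall>g. integrable M g \<longrightarrow> cmod (integral\<^sup>L M (\<lambda>x. f x * g x)) \<le> C * cstar_norm M g)"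

definition B_norm :: "'g::topological_ab_group_add measure \<Rightarrow> ('g \<Rightarrow> complex) \<Rightarrow> real" where
  "B_norm M f = Sup {cmod (integral\<^sup>L M (\<lambda>x. f x * g x)) | g. integrable M g \<and> cstar_norm M g \<le> 1}"

end

theory Submission
  imports Defs
begin

text \<open>
  Since S is clopen, normalized indicator functions of small translated neighbourhoods show that
  a finite combination of point masses whose transform is bounded by 1 on all characters takes a
  value of modulus below 4/3 on the indicator function of S. Explicit combinations with value at
  least 4/3 then rule out local patterns of S: in a progression with step d, the pattern 1?11 forces
  1111, and 11100 is impossible, so a three-term progression in S continues forever; a further
  combination shows that its step is then a period of S. Let H be the group of periods. If
  three points of S lay in distinct cosets of H, then S would contain either a triangle without its
  three completions to a parallelogram, or a parallelogram with none of the neighbouring points on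
  its sides; both are excluded. So S is a union of at most two cosets of H, and H is the
  intersection of two translates of S, hence open.

  Conversely a coset of an open subgroup has norm at most 1: the Haar functional on it is a limit of
  averages of characters, which exist in sufficient number because the circle is divisible.
\<close>

section \<open>Test polynomials on the torus\<close>

lemma cmod_le_by_square:
  assumes "(Re z)\<^sup>2 + (Im z)\<^sup>2 \<le> B\<^sup>2" "0 \<le> B"
  shows "cmod z \<le> B"
  using assms by (metis cmod_power2 power2_le_imp_le)

text \<open>The coefficients are optimal solutions of the problem dual to extending a 0-1 pattern, such
  as 1011 on a four-term progression, with minimal norm: a pattern is excluded because the
  coefficients on its ones add up to at least 4/3 of the bound on the circle.\<close>

lemma unit_bound_1011:
  assumes "cmod z = 1"
  shows "cmod (2 - 3 * z + 6 * z^2 + 4 * z^3) \<le> 9"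
proof (rule cmod_le_by_square)
  let ?P = "2 - 3 * z + 6 * z^2 + 4 * z^3"
  define x y where "x = Re z" and "y = Im z"
  have xy: "x\<^sup>2 + y\<^sup>2 = 1" using assms by (simp add: x_def y_def flip: cmod_power2)
  have x1: "x \<le> 1" using assms complex_Re_le_cmod[of z] by (simp add: x_def)
  have "Re ?P = 2 - 3*x + 6*(x\<^sup>2 - y\<^sup>2) + 4*(x^3 - 3*x*y\<^sup>2)"
    by (simp add: x_def y_def power2_eq_square power3_eq_cube algebra_simps)
  moreover have "Im ?P = - 3*y + 6*(2*x*y) + 4*(3*x\<^sup>2*y - y^3)"
    by (simp add: x_def y_def power2_eq_square power3_eq_cube algebra_simps)
  ultimately have "(Re ?P)\<^sup>2 + (Im ?P)\<^sup>2 = 81 - 16*(1-x)*(2*x+1)\<^sup>2"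
    using xy by algebra
  then show "(Re ?P)\<^sup>2 + (Im ?P)\<^sup>2 \<le> 9\<^sup>2"
    using x1 by simp
qed simp

text \<open>The gap between 81 and the squared modulus factors into visibly nonnegative terms; it
  vanishes at 1, at -1 and at the primitive sixth roots of unity.\<close>

lemma unit_bound_11100:
  assumes "cmod z = 1"
  shows "cmod (2 + 4 * z + 6 * z^2 - 4 * z^3 + z^4) \<le> 9"
proof (rule cmod_le_by_square)
  let ?P = "2 + 4 * z + 6 * z^2 - 4 * z^3 + z^4"
  define x y where "x = Re z" and "y = Im z"
  have xy: "x\<^sup>2 + y\<^sup>2 = 1" using assms by (simp add: x_def y_def flip: cmod_power2)
  have x1: "x\<^sup>2 \<le> 1" using xy by (metis le_add_same_cancel1 zero_le_power2)
  have "Re ?P = 2 + 4*x + 6*(x\<^sup>2 - y\<^sup>2) - 4*(x^3 - 3*x*y\<^sup>2) + (x^4 - 6*x\<^sup>2*y\<^sup>2 + y^4)"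
    by (simp add: x_def y_def eval_nat_numeral algebra_simps)
  moreover have "Im ?P = 4*y + 6*(2*x*y) - 4*(3*x\<^sup>2*y - y^3) + (4*x^3*y - 4*x*y^3)"
    by (simp add: x_def y_def eval_nat_numeral algebra_simps)
  ultimately have "(Re ?P)\<^sup>2 + (Im ?P)\<^sup>2 = 81 - 8*(1-x\<^sup>2)*(2*x-1)\<^sup>2"
    using xy by algebra
  then show "(Re ?P)\<^sup>2 + (Im ?P)\<^sup>2 \<le> 9\<^sup>2"
    using x1 by simp
qed simp

text \<open>The bound stays squared because the parallelogram test multiplies two such factors, and
  (6 + 6)^2 / 108 is exactly 4/3.\<close>

lemma unit_bound_0110:
  assumes "cmod z = 1"
  shows "(cmod (- 1 + 6 * z + 6 * z^2 - z^3))\<^sup>2 \<le> 108"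
proof -
  let ?P = "- 1 + 6 * z + 6 * z^2 - z^3"
  define x y where "x = Re z" and "y = Im z"
  have xy: "x\<^sup>2 + y\<^sup>2 = 1" using assms by (simp add: x_def y_def flip: cmod_power2)
  have x1: "x \<le> 1" using assms complex_Re_le_cmod[of z] by (simp add: x_def)
  have "Re ?P = -1 + 6*x + 6*(x\<^sup>2 - y\<^sup>2) - (x^3 - 3*x*y\<^sup>2)"
    by (simp add: x_def y_def power2_eq_square power3_eq_cube algebra_simps)
  moreover have "Im ?P = 6*y + 6*(2*x*y) - (3*x\<^sup>2*y - y^3)"
    by (simp add: x_def y_def power2_eq_square power3_eq_cube algebra_simps)
  ultimately have "(Re ?P)\<^sup>2 + (Im ?P)\<^sup>2 = 108 - 2*(5-x)*(2*x-1)\<^sup>2"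
    using xy by algebra
  then show ?thesis
    using x1 by (simp add: cmod_power2)
qed

text \<open>Half the distances from \<open>z\<close> to 1 and to -1 have squares adding up to 1.
  Since the phase of \<open>w\<close> is arbitrary, the triangle inequality reduces the claim to one
  real variable.\<close>

lemma unit_bound_line:
  assumes "cmod z = 1" "cmod w = 1"
  shows "cmod (5/6 * ((1 + z)/2)^4 + w * (1 - z)/2) \<le> 1"
proof -
  define s u where "s = cmod (1 - z) / 2" and "u = cmod (1 + z) / 2"
  have "(cmod (1+z))\<^sup>2 + (cmod (1-z))\<^sup>2 = 2 + 2 * (cmod z)\<^sup>2"
    by (simp add: cmod_power2) (simp add: power2_eq_square algebra_simps)
  then have us: "u\<^sup>2 = 1 - s\<^sup>2"
    using assms by (simp add: s_def u_def power_divide)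
  have s0: "0 \<le> s" and s1: "s \<le> 1"
    using norm_triangle_ineq4[of 1 z] assms by (simp_all add: s_def)
  have "cmod (5/6 * ((1 + z)/2)^4 + w * (1 - z)/2) \<le> 5/6 * u^4 + s"
    by (rule norm_triangle_le) (simp add: u_def s_def norm_mult norm_power norm_divide assms)
  also have "u^4 = (1 - s\<^sup>2)\<^sup>2" using us by (metis power2_eq_square power4_eq_xxxx mult.assoc)
  \<comment> \<open>After extracting 1 - s there remains 1 - 5/6 * (1 - s) * (1 + s)^2, whose
    minimum on the unit interval is 1/81, at s = 1/3; the square is centred there.\<close>
  also have "5/6 * (1 - s\<^sup>2)\<^sup>2 + s = 1 - (1 - s) * (1/81 + 5/6 * (s - 1/3)\<^sup>2 * (s + 5/3))"
    by algebra
  also have "\<dots> \<le> 1" using s0 s1 by simp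
  finally show ?thesis .
qed

text \<open>The expression is homogeneous of degree 1, so the mean phase of \<open>b\<close> and
  \<open>c\<close> factors out and these two become conjugate. What remains is a quadratic in
  \<open>cos s\<close> with coefficients depending on \<open>cos t\<close>.\<close>

lemma unit_bound_triangle:
  assumes "cmod a = 1" "cmod b = 1" "cmod c = 1"
  shows "cmod (4 * (a + b + c) - (a * b / c + b * c / a + c * a / b)) \<le> 9"
proof -
  define m t where "m = (Arg b + Arg c) / 2" and "t = (Arg b - Arg c) / 2"
  define s where "s = m - Arg a"
  have unit: "z = cis (Arg z)" if "cmod z = 1" for z
    using rcis_cmod_Arg[of z] that by (simp add: rcis_def)
  have a: "a = cis m * cis (- s)" using unit[OF assms(1)] by (simp add: s_def cis_mult)
  have b: "b = cis m * cis t" using unit[OF assms(2)] by (simp add: m_def t_def cis_mult field_simps)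
  have c: "c = cis m * cis (- t)" using unit[OF assms(3)] by (simp add: m_def t_def cis_mult field_simps)
  let ?P = "4 * (a + b + c) - (a * b / c + b * c / a + c * a / b)"
  let ?Q = "4 * (cis (- s) + cis t + cis (- t)) - (cis (2*t - s) + cis s + cis (- 2*t - s))"
  define C y v where "C = cos t" and "y = cos s" and "v = sin s"
  have yv: "y\<^sup>2 + v\<^sup>2 = 1" by (simp add: y_def v_def)
  have "a * b / c = cis m * cis (2*t - s)" "b * c / a = cis m * cis s" "c * a / b = cis m * cis (- 2*t - s)"
    by (simp_all add: a b c cis_mult cis_divide)
  then have "?P = cis m * ?Q" by (simp add: a b c algebra_simps)
  then have "cmod ?P = cmod ?Q" by (simp add: norm_mult)
  moreover have "cmod ?Q \<le> 9"
  proof (rule cmod_le_by_square)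
    have "Re ?Q = 8*C + (5 - 4*C\<^sup>2) * y"
      by (simp add: C_def y_def cos_diff cos_add cos_double_cos) (simp add: algebra_simps)
    moreover have "Im ?Q = - ((7 - 4*C\<^sup>2) * v)"
      by (simp add: C_def v_def sin_diff sin_add cos_double_cos) (simp add: algebra_simps)
    ultimately have eq: "(Re ?Q)\<^sup>2 + (Im ?Q)\<^sup>2 =
        81 - 8 * ((3 - 2*C\<^sup>2) * y\<^sup>2 - 2*C*(5 - 4*C\<^sup>2)*y + (4 - C\<^sup>2 - 2*C^4))"
      using yv by algebra
    have C1: "C\<^sup>2 \<le> 1" by (simp add: C_def abs_square_le_1)
    \<comment> \<open>Multiplying by the leading coefficient, which is at least 1, completes the
      square in \<open>y\<close>.\<close>
    have "(3 - 2*C\<^sup>2) * ((3 - 2*C\<^sup>2) * y\<^sup>2 - 2*C*(5 - 4*C\<^sup>2)*y + (4 - C\<^sup>2 - 2*C^4))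
        = ((3 - 2*C\<^sup>2) * y - C*(5 - 4*C\<^sup>2))\<^sup>2 + 12 * (1 - C\<^sup>2)^3"
      by algebra
    also have "\<dots> \<ge> 0" using C1 by simp
    finally have "0 \<le> (3 - 2*C\<^sup>2) * y\<^sup>2 - 2*C*(5 - 4*C\<^sup>2)*y + (4 - C\<^sup>2 - 2*C^4)"
      using C1 by (simp add: zero_le_mult_iff)
    then show "(Re ?Q)\<^sup>2 + (Im ?Q)\<^sup>2 \<le> 9\<^sup>2" unfolding eq by simp
  qed simp
  ultimately show ?thesis by simp
qed

section \<open>Excluded patterns and the group of periods\<close>

text \<open>Continuity is left out: a bound over all these homomorphisms covers the continuous
  characters, and the pattern arguments need only the group structure.\<close>

definition unit_hom :: "('g::ab_group_add \<Rightarrow> complex) \<Rightarrow> bool" where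
  "unit_hom \<gamma> \<longleftrightarrow> (\<forall>x. cmod (\<gamma> x) = 1) \<and> (\<forall>x y. \<gamma> (x + y) = \<gamma> x * \<gamma> y)"

text \<open>A list of weighted points lets entries coincide, so the tests stay valid when a step is
  zero or has small order.\<close>

definition pairing :: "(real \<times> 'g) list \<Rightarrow> ('g \<Rightarrow> complex) \<Rightarrow> complex" where
  "pairing l f = (\<Sum>(c, x)\<leftarrow>l. of_real c * f x)"

lemma pairing_simps [simp]:
  "pairing [] f = 0"
  "pairing ((c, x) # l) f = of_real c * f x + pairing l f"
  by (simp_all add: pairing_def)

lemma unit_hom_norm: "unit_hom \<gamma> \<Longrightarrow> cmod (\<gamma> x) = 1"
  by (simp add: unit_hom_def)

lemma unit_hom_nonzero: "unit_hom \<gamma> \<Longrightarrow> \<gamma> x \<noteq> 0"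
  by (metis norm_zero unit_hom_norm zero_neq_one)

lemma unit_hom_add: "unit_hom \<gamma> \<Longrightarrow> \<gamma> (x + y) = \<gamma> x * \<gamma> y"
  by (simp add: unit_hom_def)

lemma unit_hom_diff: "unit_hom \<gamma> \<Longrightarrow> \<gamma> (x - y) = \<gamma> x / \<gamma> y"
  by (metis diff_add_cancel nonzero_mult_div_cancel_right unit_hom_add unit_hom_nonzero)

lemma mem_coset_iff: "x \<in> coset a K \<longleftrightarrow> x - a \<in> K"
  unfolding coset_def by (force simp: image_iff)

text \<open>The only trace of the norm bound in the combinatorial part: a pattern is impossible once
  some test bounded by 1 on all homomorphisms takes a value of at least 4/3 on it.\<close>

locale small_idempotent =
  fixes S :: "'g::ab_group_add set"
  assumes test: "(\<And>\<gamma>. unit_hom \<gamma> \<Longrightarrow> cmod (pairing l \<gamma>) \<le> 1) \<Longrightarrow>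
                 Re (pairing l (indicator S)) < 4 / 3"
begin

lemma pattern_1011:
  assumes "x \<in> S" "x + d + d \<in> S" "x + d + d + d \<in> S"
  shows "x + d \<in> S"
proof (rule ccontr)
  assume *: "x + d \<notin> S"
  \<comment> \<open>The three points of \<open>S\<close> carry 2/9 + 6/9 + 4/9 = 4/3, and the absent
    one contributes nothing.\<close>
  let ?l = "[(2/9, x), (-3/9, x + d), (6/9, x + d + d), (4/9, x + d + d + d)]"
  have "Re (pairing ?l (indicator S)) < 4 / 3"
  proof (rule test)
    fix \<gamma> :: "'g \<Rightarrow> complex" assume \<gamma>: "unit_hom \<gamma>"
    have eq: "pairing ?l \<gamma> = \<gamma> x * ((2 - 3 * \<gamma> d + 6 * \<gamma> d^2 + 4 * \<gamma> d^3) / 9)"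
      by (simp add: unit_hom_add[OF \<gamma>] field_simps eval_nat_numeral)
    show "cmod (pairing ?l \<gamma>) \<le> 1"
      unfolding eq using unit_bound_1011[of "\<gamma> d"] by (simp add: norm_mult norm_divide unit_hom_norm[OF \<gamma>])
  qed
  then show False using assms * by simp
qed

lemma pattern_11100:
  assumes "x \<in> S" "x + d \<in> S" "x + d + d \<in> S" "x + d + d + d \<notin> S" "x + d + d + d + d \<notin> S"
  shows False
proof -
  let ?l = "[(2/9, x), (4/9, x + d), (6/9, x + d + d), (-4/9, x + d + d + d), (1/9, x + d + d + d + d)]"
  have "Re (pairing ?l (indicator S)) < 4 / 3"
  proof (rule test)
    fix \<gamma> :: "'g \<Rightarrow> complex" assume \<gamma>: "unit_hom \<gamma>"
    have eq: "pairing ?l \<gamma> = \<gamma> x * ((2 + 4 * \<gamma> d + 6 * \<gamma> d^2 - 4 * \<gamma> d^3 + \<gamma> d^4) / 9)"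
      by (simp add: unit_hom_add[OF \<gamma>] field_simps eval_nat_numeral)
    show "cmod (pairing ?l \<gamma>) \<le> 1"
      unfolding eq using unit_bound_11100[of "\<gamma> d"] by (simp add: norm_mult norm_divide unit_hom_norm[OF \<gamma>])
  qed
  then show False using assms by simp
qed

text \<open>If the fourth term were absent, the fifth would be present by
  \<open>pattern_11100\<close>; read backwards from there, the pattern 1?11 forces the
  fourth.\<close>

lemma progression_step:
  assumes "x \<in> S" "x + d \<in> S" "x + d + d \<in> S"
  shows "x + d + d + d \<in> S"
proof (rule ccontr)
  assume *: "x + d + d + d \<notin> S"
  with pattern_11100[OF assms] have "x + d + d + d + d \<in> S" by blast
  with pattern_1011[of "x + d + d + d + d" "- d"] assms * show False by simp
qed

lemma progression_transport:
  assumes "x \<in> S" "x + d \<in> S" "x + d + d \<in> S" "z \<in> S"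
  shows "z + d \<in> S"
proof (rule ccontr)
  assume *: "z + d \<notin> S"
  have S: "x + d + d + d \<in> S" "x + d + d + d + d \<in> S"
    using progression_step[of x d] progression_step[of "x + d" d] assms by simp_all
  \<comment> \<open>Binomial weights of total mass 5/6 on five terms of the progression, plus a
    dipole at \<open>z\<close> and \<open>z + d\<close>. The value is 5/6 + 1/2 = 4/3.\<close>
  let ?l = "[(5/96, x), (20/96, x + d), (30/96, x + d + d), (20/96, x + d + d + d),
             (5/96, x + d + d + d + d), (1/2, z), (-1/2, z + d)]"
  have "Re (pairing ?l (indicator S)) < 4 / 3"
  proof (rule test)
    fix \<gamma> :: "'g \<Rightarrow> complex" assume \<gamma>: "unit_hom \<gamma>"
    have eq: "pairing ?l \<gamma> = \<gamma> x * (5/6 * ((1 + \<gamma> d)/2)^4 + \<gamma> z / \<gamma> x * (1 - \<gamma> d)/2)"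
      by (simp add: unit_hom_nonzero[OF \<gamma>] unit_hom_add[OF \<gamma>] field_simps eval_nat_numeral)
    show "cmod (pairing ?l \<gamma>) \<le> 1"
      unfolding eq using unit_bound_line[of "\<gamma> d" "\<gamma> z / \<gamma> x"] by (simp add: norm_mult norm_divide unit_hom_norm[OF \<gamma>])
  qed
  then show False using assms S * by simp
qed

text \<open>The three excluded points complete the triangle to its three parallelograms. With these
  absent, the weights 4/9 at the vertices add up to 4/3.\<close>

lemma pattern_triangle:
  assumes "x \<in> S" "y \<in> S" "z \<in> S" "x + y - z \<notin> S" "y + z - x \<notin> S" "z + x - y \<notin> S"
  shows False
proof -
  let ?l = "[(4/9, x), (4/9, y), (4/9, z), (-1/9, x + y - z), (-1/9, y + z - x), (-1/9, z + x - y)]"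
  have "Re (pairing ?l (indicator S)) < 4 / 3"
  proof (rule test)
    fix \<gamma> :: "'g \<Rightarrow> complex" assume \<gamma>: "unit_hom \<gamma>"
    have eq: "pairing ?l \<gamma> = (4 * (\<gamma> x + \<gamma> y + \<gamma> z)
        - (\<gamma> x * \<gamma> y / \<gamma> z + \<gamma> y * \<gamma> z / \<gamma> x + \<gamma> z * \<gamma> x / \<gamma> y)) / 9"
      by (simp add: unit_hom_add[OF \<gamma>] unit_hom_diff[OF \<gamma>] add_divide_distrib diff_divide_distrib ac_simps)
    show "cmod (pairing ?l \<gamma>) \<le> 1"
      unfolding eq using unit_bound_triangle[of "\<gamma> x" "\<gamma> y" "\<gamma> z"] by (simp add: norm_divide unit_hom_norm[OF \<gamma>])
  qed
  then show False using assms by simp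
qed

text \<open>The product of two copies of the test for the pattern 0110; the corners get positive
  weight, so their membership is irrelevant.\<close>

lemma pattern_parallelogram:
  assumes one: "z \<in> S" "z + s \<in> S" "z + t \<in> S" "z + s + t \<in> S"
    and zero: "z - s \<notin> S" "z + s + s \<notin> S" "z + t - s \<notin> S" "z + t + s + s \<notin> S"
      "z - t \<notin> S" "z + t + t \<notin> S" "z + s - t \<notin> S" "z + s + t + t \<notin> S"
  shows False
proof -
  \<comment> \<open>The outer product of (-1, 6, 6, -1) with itself, divided by 108. The four inner
    weights alone give 144/108 = 4/3.\<close>
  let ?l = "[(1/108, z - s - t), (-6/108, z - t), (-6/108, z + s - t), (1/108, z + s + s - t),
    (-6/108, z - s), (36/108, z), (36/108, z + s), (-6/108, z + s + s),
    (-6/108, z + t - s), (36/108, z + t), (36/108, z + s + t), (-6/108, z + t + s + s),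
    (1/108, z + t + t - s), (-6/108, z + t + t), (-6/108, z + s + t + t), (1/108, z + s + s + t + t)]"
  have "Re (pairing ?l (indicator S)) < 4 / 3"
  proof (rule test)
    fix \<gamma> :: "'g \<Rightarrow> complex" assume \<gamma>: "unit_hom \<gamma>"
    let ?p = "\<lambda>u. - 1 + 6 * u + 6 * u^2 - u^3 :: complex"
    have eq: "pairing ?l \<gamma> = \<gamma> z / (\<gamma> s * \<gamma> t) * (?p (\<gamma> s) * ?p (\<gamma> t) / 108)"
      by (simp add: unit_hom_nonzero[OF \<gamma>] unit_hom_add[OF \<gamma>] unit_hom_diff[OF \<gamma>] divide_simps)
        (simp add: algebra_simps eval_nat_numeral)
    have "cmod (?p (\<gamma> s)) * cmod (?p (\<gamma> t)) \<le> sqrt 108 * sqrt 108"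
      by (intro mult_mono real_le_rsqrt unit_bound_0110 unit_hom_norm[OF \<gamma>]) simp_all
    then show "cmod (pairing ?l \<gamma>) \<le> 1"
      unfolding eq by (simp add: norm_mult norm_divide unit_hom_norm[OF \<gamma>])
  qed
  then show False using one zero by (auto simp: indicator_def of_bool_def split: if_splits)
qed

section \<open>The group of periods of S\<close>

definition stab :: "'g set" where
  "stab = {d. \<forall>z. z \<in> S \<longleftrightarrow> z + d \<in> S}"

lemma stab_iff: "d \<in> stab \<Longrightarrow> z + d \<in> S \<longleftrightarrow> z \<in> S"
  by (simp add: stab_def)

lemma stab_zero: "0 \<in> stab"
  by (simp add: stab_def)

lemma stab_diff: "c \<in> stab \<Longrightarrow> d \<in> stab \<Longrightarrow> c - d \<in> stab"
  unfolding stab_def by clarsimp (metis add_diff_cancel add_diff_eq diff_add_cancel)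

lemma is_subgroup_stab: "is_subgroup stab"
  by (simp add: is_subgroup_def stab_zero stab_diff)

lemma stab_uminus: "d \<in> stab \<Longrightarrow> - d \<in> stab"
  using stab_diff[OF stab_zero] by fastforce

text \<open>The same progression read in reverse has step \<open>- d\<close>, so both translations
  preserve \<open>S\<close>.\<close>

lemma progression_stab:
  assumes "x \<in> S" "x + d \<in> S" "x + d + d \<in> S"
  shows "d \<in> stab"
proof -
  have "z - d \<in> S" if "z \<in> S" for z
    using progression_transport[of "x + d + d" "- d" z] assms that by simp
  then have "z \<in> S" if "z + d \<in> S" for z
    using that by (metis add_diff_cancel)
  with progression_transport[OF assms] show ?thesis
    unfolding stab_def by blast
qed

lemma not_stab_outer:
  assumes "x \<in> S" "x + d \<in> S" "d \<notin> stab"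
  shows "x + d + d \<notin> S" "x - d \<notin> S"
  using progression_stab[of x d] progression_stab[of "x - d" d] assms by auto

text \<open>If neither side were a period, none of the four edges could be prolonged within
  \<open>S\<close> in either direction. This supplies the eight absent points of
  \<open>pattern_parallelogram\<close>.\<close>

lemma parallelogram_stab:
  assumes "z \<in> S" "z + s \<in> S" "z + t \<in> S" "z + s + t \<in> S"
  shows "s \<in> stab \<or> t \<in> stab"
proof (rule ccontr)
  assume "\<not> ?thesis"
  then show False
    using pattern_parallelogram[OF assms] not_stab_outer[of z s] not_stab_outer[of "z + t" s]
      not_stab_outer[of z t] not_stab_outer[of "z + s" t] assms
    by (simp add: ac_simps)
qed

text \<open>By \<open>pattern_triangle\<close> one of the three completions to a parallelogram lies
  in \<open>S\<close>; then one of its two sides is a period.\<close>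

lemma two_classes:
  assumes "x \<in> S" "y \<in> S" "z \<in> S"
  shows "y - x \<in> stab \<or> z - x \<in> stab \<or> z - y \<in> stab"
proof -
  have sym: "a - b \<in> stab \<Longrightarrow> b - a \<in> stab" for a b
    using stab_uminus by fastforce
  have par: "p - r \<in> stab \<or> q - r \<in> stab"
    if "p \<in> S" "q \<in> S" "r \<in> S" "p + q - r \<in> S" for p q r
    using parallelogram_stab[of r "p - r" "q - r"] that by (simp add: algebra_simps)
  show ?thesis
    using pattern_triangle[OF assms] par[of x y z] par[of y z x] par[of z x y] assms sym by blast
qed

lemma coset_stab:
  assumes "a \<in> S"
  shows "coset a stab \<subseteq> S"
  using assms by (auto simp: coset_def stab_iff)

lemma union_of_two_cosets:
  assumes "S \<noteq> {}" and "\<not> (\<exists>K c. is_subgroup K \<and> S = coset c K)"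
  obtains a b where "a \<in> S" "b \<in> S" "b - a \<notin> stab" "S = coset a stab \<union> coset b stab"
proof -
  obtain a where a: "a \<in> S" using assms by blast
  have "S \<noteq> coset a stab" using assms is_subgroup_stab by blast
  with coset_stab[OF a] obtain b where b: "b \<in> S" "b \<notin> coset a stab" by blast
  then have ab: "b - a \<notin> stab" by (simp add: mem_coset_iff)
  have "x \<in> coset a stab \<union> coset b stab" if "x \<in> S" for x
    using two_classes[OF a b(1) that] ab by (simp add: mem_coset_iff)
  with coset_stab a b(1) have "S = coset a stab \<union> coset b stab" by blast
  with that a b ab show ?thesis by blast
qed

text \<open>Exhibits the periods as an intersection of two translates of \<open>S\<close>, which
  will give openness. The points \<open>a\<close>, \<open>b\<close>, \<open>a + x\<close>,
  \<open>b + x\<close> form a parallelogram whose side \<open>b - a\<close> is not a period, so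
  \<open>x\<close> is one.\<close>

lemma stab_eq:
  assumes "a \<in> S" "b \<in> S" "b - a \<notin> stab"
  shows "stab = {x. a + x \<in> S \<and> b + x \<in> S}"
proof (intro set_eqI iffI CollectI conjI)
  fix x assume "x \<in> {x. a + x \<in> S \<and> b + x \<in> S}"
  then have x: "a + x \<in> S" "b + x \<in> S" by auto
  show "x \<in> stab"
    using parallelogram_stab[of a "b - a" x] assms x by (simp add: algebra_simps)
qed (use assms in \<open>simp_all add: stab_iff\<close>)

end

section \<open>Extension of characters\<close>

text \<open>A character of a subgroup is represented by its graph, a subgroup of the product with the
  circle that meets the circle trivially.\<close>

definition circle_graph :: "('g::ab_group_add \<times> complex) set \<Rightarrow> bool" where
  "circle_graph R \<longleftrightarrow> (0, 1) \<in> R \<and> (\<forall>x u. (x, u) \<in> R \<longrightarrow> cmod u = 1) \<and>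
     (\<forall>x u y v. (x, u) \<in> R \<longrightarrow> (y, v) \<in> R \<longrightarrow> (x - y, u / v) \<in> R) \<and> (\<forall>u. (0, u) \<in> R \<longrightarrow> u = 1)"

lemma circle_graphD:
  assumes "circle_graph R"
  shows "(0, 1) \<in> R" "(x, u) \<in> R \<Longrightarrow> cmod u = 1"
    "(x, u) \<in> R \<Longrightarrow> (y, v) \<in> R \<Longrightarrow> (x - y, u / v) \<in> R" "(0, u) \<in> R \<Longrightarrow> u = 1"
  using assms unfolding circle_graph_def by blast+

lemma circle_graph_add:
  assumes "circle_graph R" "(x, u) \<in> R" "(y, v) \<in> R"
  shows "(x + y, u * v) \<in> R"
  using circle_graphD(3)[OF assms(1,2) circle_graphD(3)[OF assms(1) circle_graphD(1)[OF assms(1)] assms(3)]]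
  by simp

lemma circle_graph_unique:
  assumes "circle_graph R" "(x, u) \<in> R" "(x, v) \<in> R"
  shows "u = v"
proof -
  have "(0, u / v) \<in> R" using circle_graphD(3)[OF assms] by simp
  then have "u / v = 1" by (rule circle_graphD(4)[OF assms(1)])
  then show ?thesis by simp
qed

lemma nontrivial_root_of_unit:
  assumes "cmod w = 1" "2 \<le> n"
  obtains \<zeta> where "cmod \<zeta> = 1" "\<zeta> ^ n = w" "\<zeta> \<noteq> 1"
proof
  \<comment> \<open>Adding a full turn before dividing keeps the angle strictly between 0 and a full
    turn, whereas the principal root would be 1 for w = 1.\<close>
  define \<theta> where "\<theta> = (Arg w + 2 * pi) / n"
  have n: "2 \<le> real n" using assms(2) by simp
  have "\<theta> \<le> (3 * pi) / 2"
    unfolding \<theta>_def using n Arg_le_pi[of w] pi_gt_zero by (intro frac_le) auto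
  moreover have "0 < \<theta>"
    unfolding \<theta>_def using n mpi_less_Arg[of w] pi_gt_zero by (intro divide_pos_pos) linarith+
  ultimately have \<theta>: "0 < \<theta>" "\<theta> < 2 * pi" using pi_gt_zero by linarith+
  show "cmod (cis \<theta>) = 1" by simp
  have "real n * \<theta> = Arg w + 2 * pi" using n by (simp add: \<theta>_def)
  then have "cis \<theta> ^ n = cis (Arg w + 2 * pi)" by (simp add: Complex.DeMoivre)
  also have "\<dots> = w"
    using rcis_cmod_Arg[of w] assms(1) by (simp add: rcis_def flip: cis_mult)
  finally show "cis \<theta> ^ n = w" .
  show "cis \<theta> \<noteq> 1"
  proof
    assume "cis \<theta> = 1"
    then have "cos \<theta> = 1" by (metis cis.sel(1) one_complex.sel(1))
    then obtain k :: int where k: "\<theta> = k * (2 * pi)"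
      unfolding cos_one_2pi_int by (auto simp: mult.assoc)
    with \<theta> have "0 < k" "k < 1" by (auto simp: zero_less_mult_iff)
    then show False by simp
  qed
qed

text \<open>The value at \<open>e\<close> must agree with the values already prescribed on multiples
  of \<open>e\<close>. Divisibility of the circle provides such a value, and it can be taken
  different from 1 because \<open>e\<close> itself is not in the domain.\<close>

lemma circle_graph_extend:
  fixes e :: "'g::ab_group_add"
  assumes R: "circle_graph R" and e: "e \<notin> Domain R"
  obtains R' \<zeta> where "circle_graph R'" "R \<subseteq> R'" "(e, \<zeta>) \<in> R'" "\<zeta> \<noteq> 1"
proof -
  define mul where "mul k = (\<Sum>i<k. e)" for k :: nat
  have mul_simps [simp]: "mul 0 = 0" "mul (Suc k) = mul k + e" for k
    by (simp_all add: mul_def)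
  have mul_add: "mul (j + k) = mul j + mul k" for j k
    by (induction k) (simp_all add: ac_simps)
  obtain \<zeta> where \<zeta>: "cmod \<zeta> = 1" "\<zeta> \<noteq> 1" and root: "\<And>k u. (mul k, u) \<in> R \<Longrightarrow> u = \<zeta> ^ k"
  proof (cases "\<exists>k>0. mul k \<in> Domain R")
    case False
    \<comment> \<open>Only the zero multiple lies in the domain, so every unit value is compatible;
      -1 is one that differs from 1.\<close>
    have "u = (-1) ^ k" if "(mul k, u) \<in> R" for k u
    proof -
      have "k = 0" using False that by (meson DomainI gr0I)
      then show ?thesis using that circle_graphD(4)[OF R] by simp
    qed
    then show ?thesis using that[of "-1"] by simp
  next
    case True
    define n where "n = (LEAST k. 0 < k \<and> mul k \<in> Domain R)"
    have n: "0 < n" "mul n \<in> Domain R"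
      using LeastI_ex[OF True] by (auto simp: n_def)
    have least: "k = 0" if "k < n" "mul k \<in> Domain R" for k
      using that not_less_Least[of k "\<lambda>k. 0 < k \<and> mul k \<in> Domain R"] by (auto simp: n_def)
    have "n \<noteq> 1" using n(2) e by (auto simp: mul_def)
    with n have n2: "2 \<le> n" by simp
    obtain w where w: "(mul n, w) \<in> R" using n(2) by blast
    obtain \<zeta> where \<zeta>: "cmod \<zeta> = 1" "\<zeta> ^ n = w" "\<zeta> \<noteq> 1"
      using nontrivial_root_of_unit[OF circle_graphD(2)[OF R w] n2] by blast
    have mult: "(mul (n * q), w ^ q) \<in> R" for q
      by (induction q) (use circle_graphD(1)[OF R] circle_graph_add[OF R w] in \<open>auto simp: mul_add\<close>)
    have "u = \<zeta> ^ k" if "(mul k, u) \<in> R" for k u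
    proof -
      \<comment> \<open>Division by \<open>n\<close>: the remainder is again the index of a multiple
        in the domain, hence 0 by minimality of \<open>n\<close>.\<close>
      have k: "k = n * (k div n) + k mod n" by simp
      have "mul k - mul (n * (k div n)) = mul (k mod n)"
        by (subst k, simp only: mul_add) simp
      then have mem: "(mul (k mod n), u / w ^ (k div n)) \<in> R"
        using circle_graphD(3)[OF R that mult[of "k div n"]] by simp
      then have 0: "k mod n = 0" using least n(1) by (meson DomainI mod_less_divisor)
      with mem have "(0, u / w ^ (k div n)) \<in> R" by simp
      then have "u / w ^ (k div n) = 1" by (rule circle_graphD(4)[OF R])
      then have "u = w ^ (k div n)" by (simp add: divide_eq_1_iff)
      also have "\<dots> = \<zeta> ^ (n * (k div n))" by (simp add: \<zeta> power_mult)
      also have "n * (k div n) = k" using 0 by auto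
      finally show ?thesis .
    qed
    then show ?thesis using that \<zeta> by blast
  qed
  have \<zeta>0: "\<zeta> \<noteq> 0" using \<zeta> by auto
  \<comment> \<open>The graph generated by \<open>R\<close> and the new pair; integer multiples
    appear as differences of natural ones.\<close>
  define R' where "R' = {(x + mul a - mul b, u * \<zeta> ^ a / \<zeta> ^ b) | x u a b. (x, u) \<in> R}"
  have R'I: "(x + mul a - mul b, u * \<zeta> ^ a / \<zeta> ^ b) \<in> R'" if "(x, u) \<in> R" for x u a b
    using that unfolding R'_def by blast
  have "R \<subseteq> R'"
    using R'I[of _ _ 0 0] by auto
  moreover have "(e, \<zeta>) \<in> R'"
    using R'I[OF circle_graphD(1)[OF R], of 1 0] by simp
  moreover have "circle_graph R'"
    unfolding circle_graph_def
  proof (intro conjI allI impI)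
    show "(0, 1) \<in> R'" using \<open>R \<subseteq> R'\<close> circle_graphD(1)[OF R] by blast
  next
    fix x u assume "(x, u) \<in> R'"
    then show "cmod u = 1"
      using circle_graphD(2)[OF R] \<zeta> by (auto simp: R'_def norm_mult norm_divide norm_power)
  next
    fix x u y v assume "(x, u) \<in> R'" "(y, v) \<in> R'"
    then obtain x0 u0 a b y0 v0 c d where *: "(x0, u0) \<in> R" "(y0, v0) \<in> R"
      "x = x0 + mul a - mul b" "u = u0 * \<zeta> ^ a / \<zeta> ^ b" "y = y0 + mul c - mul d" "v = v0 * \<zeta> ^ c / \<zeta> ^ d"
      unfolding R'_def by blast
    have "((x0 - y0) + mul (a + d) - mul (b + c), (u0 / v0) * \<zeta> ^ (a + d) / \<zeta> ^ (b + c)) \<in> R'"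
      using R'I circle_graphD(3)[OF R *(1,2)] by blast
    moreover have "(x0 - y0) + mul (a + d) - mul (b + c) = x - y"
      by (simp add: * mul_add)
    moreover have "(u0 / v0) * \<zeta> ^ (a + d) / \<zeta> ^ (b + c) = u / v"
      using \<zeta>0 by (simp add: * power_add field_simps)
    ultimately show "(x - y, u / v) \<in> R'" by simp
  next
    fix u assume "(0, u) \<in> R'"
    then obtain x u0 a b where *: "(x, u0) \<in> R" "0 = x + mul a - mul b" "u = u0 * \<zeta> ^ a / \<zeta> ^ b"
      unfolding R'_def by blast
    \<comment> \<open>Depending on which of \<open>a\<close> and \<open>b\<close> is larger,
      \<open>x\<close> or its negative is a natural multiple of \<open>e\<close>, and
      \<open>root\<close> determines its value.\<close>
    show "u = 1"
    proof (cases "a \<le> b")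
      case True
      then have b: "b = a + (b - a)" by simp
      have "mul b = mul a + mul (b - a)" by (subst b, rule mul_add)
      with *(2) have "x = mul (b - a)" by (simp add: algebra_simps)
      with root *(1) have "u0 = \<zeta> ^ (b - a)" by blast
      then have "u0 * \<zeta> ^ a = \<zeta> ^ b" using True by (simp flip: power_add)
      then show ?thesis using *(3) \<zeta>0 by simp
    next
      case False
      then have a: "a = b + (a - b)" by simp
      have "mul a = mul b + mul (a - b)" by (subst a, rule mul_add)
      with *(2) have "0 - x = mul (a - b)" by (simp add: algebra_simps neg_eq_iff_add_eq_0)
      with root circle_graphD(3)[OF R circle_graphD(1)[OF R] *(1)] have "1 / u0 = \<zeta> ^ (a - b)" by metis
      moreover have "u0 \<noteq> 0" using circle_graphD(2)[OF R *(1)] by auto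
      ultimately have "u0 * \<zeta> ^ (a - b) = 1" by (metis nonzero_mult_div_cancel_left times_divide_eq_right mult.right_neutral)
      moreover have "\<zeta> ^ a = \<zeta> ^ (a - b) * \<zeta> ^ b" using False by (simp flip: power_add)
      ultimately show ?thesis using *(3) \<zeta>0 by simp
    qed
  qed
  ultimately show ?thesis using that \<zeta>(2) by blast
qed

text \<open>Zorn's lemma: a maximal graph containing \<open>R\<close> is defined everywhere, since
  otherwise \<open>circle_graph_extend\<close> would enlarge it.\<close>

lemma unit_hom_extension:
  assumes "circle_graph R"
  obtains \<psi> where "unit_hom \<psi>" "\<And>x u. (x, u) \<in> R \<Longrightarrow> \<psi> x = u"
proof -
  let ?A = "{Q. circle_graph Q \<and> R \<subseteq> Q}"
  have "\<exists>Q\<in>?A. \<forall>X\<in>?A. Q \<subseteq> X \<longrightarrow> X = Q"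
  proof (rule subset_Zorn_nonempty)
    fix C assume C: "C \<noteq> {}" "subset.chain ?A C"
    then have graph: "circle_graph Q" "R \<subseteq> Q" if "Q \<in> C" for Q
      using that by (auto simp: subset_chain_def)
    have common: "\<exists>Q\<in>C. p \<in> Q \<and> q \<in> Q" if pq: "p \<in> \<Union>C" "q \<in> \<Union>C" for p q
    proof -
      obtain A B where AB: "A \<in> C" "B \<in> C" "p \<in> A" "q \<in> B" using pq by blast
      then have "A \<subseteq> B \<or> B \<subseteq> A" using C(2) unfolding subset_chain_def by blast
      with AB show ?thesis by blast
    qed
    have "circle_graph (\<Union>C)"
      unfolding circle_graph_def
    proof (intro conjI allI impI)
      show "(0, 1) \<in> \<Union>C" using C(1) circle_graphD(1)[OF graph(1)] by blast
    next
      fix x u y v assume "(x, u) \<in> \<Union>C" "(y, v) \<in> \<Union>C"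
      then obtain Q where Q: "Q \<in> C" "(x, u) \<in> Q" "(y, v) \<in> Q" using common by blast
      then have "(x - y, u / v) \<in> Q" using circle_graphD(3)[OF graph(1)] by simp
      with Q(1) show "(x - y, u / v) \<in> \<Union>C" by blast
    qed (use circle_graphD(2,4)[OF graph(1)] in blast)+
    then show "\<Union>C \<in> ?A" using C(1) graph(2) by blast
  qed (use assms in blast)
  then obtain Q where QA: "Q \<in> ?A" and max: "\<forall>X\<in>?A. Q \<subseteq> X \<longrightarrow> X = Q" by (rule bexE)
  then have Q: "circle_graph Q" "R \<subseteq> Q" by simp_all
  have dom: "x \<in> Domain Q" for x
  proof (rule ccontr)
    assume x: "x \<notin> Domain Q"
    from circle_graph_extend[OF Q(1) x] obtain R' \<zeta>
      where R': "circle_graph R'" "Q \<subseteq> R'" "(x, \<zeta>) \<in> R'" by blast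
    then have "R' = Q" using Q(2) by (intro max[rule_format]) auto
    with R'(3) x show False by blast
  qed
  define \<psi> where "\<psi> x = (THE u. (x, u) \<in> Q)" for x
  have \<psi>I: "\<psi> x = u" if "(x, u) \<in> Q" for x u
    unfolding \<psi>_def using that circle_graph_unique[OF Q(1) _ that] by (intro the_equality)
  have \<psi>: "(x, \<psi> x) \<in> Q" for x
    using dom[of x] by (auto simp: \<psi>I)
  have "unit_hom \<psi>"
    using circle_graphD(2)[OF Q(1) \<psi>] \<psi>I[OF circle_graph_add[OF Q(1) \<psi> \<psi>]] by (simp add: unit_hom_def)
  moreover have "\<psi> x = u" if "(x, u) \<in> R" for x u
    using that Q(2) by (intro \<psi>I) blast
  ultimately show ?thesis by (rule that)
qed

text \<open>The trivial character of \<open>K\<close> is first extended to \<open>d\<close> with a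
  value other than 1, then to the whole group.\<close>

lemma unit_hom_separating:
  assumes K: "is_subgroup K" and d: "d \<notin> K"
  obtains \<psi> where "unit_hom \<psi>" "\<And>k. k \<in> K \<Longrightarrow> \<psi> k = 1" "\<psi> d \<noteq> 1"
proof -
  have "circle_graph (K \<times> {1})" "d \<notin> Domain (K \<times> {1::complex})"
    using K d by (auto simp: circle_graph_def is_subgroup_def)
  then obtain R \<zeta> where R: "circle_graph R" "K \<times> {1} \<subseteq> R" "(d, \<zeta>) \<in> R" "\<zeta> \<noteq> 1"
    using circle_graph_extend by blast
  from unit_hom_extension[OF R(1)] obtain \<psi> where "unit_hom \<psi>" "\<And>x u. (x, u) \<in> R \<Longrightarrow> \<psi> x = u" by blast
  with R that[of \<psi>] show ?thesis by blast
qed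

section \<open>Continuous characters trivial on an open subgroup\<close>

lemma open_coset:
  fixes K :: "'g::topological_ab_group_add set"
  assumes "open K"
  shows "open (coset a K)"
proof -
  have "coset a K = (\<lambda>x. x - a) -` K" by (auto simp: mem_coset_iff)
  then show ?thesis by (simp add: assms open_vimage continuous_intros)
qed

text \<open>Continuity is automatic: a homomorphism trivial on \<open>K\<close> is constant on the
  open cosets of \<open>K\<close>, so all preimages are open.\<close>

lemma character_separating:
  fixes K :: "'g::topological_ab_group_add set"
  assumes K: "is_subgroup K" "open K" and d: "d \<notin> K"
  obtains \<psi> where "is_character \<psi>" "\<And>k. k \<in> K \<Longrightarrow> \<psi> k = 1" "\<psi> d \<noteq> 1"
proof -
  obtain \<psi> where \<psi>: "unit_hom \<psi>" "\<And>k. k \<in> K \<Longrightarrow> \<psi> k = 1" "\<psi> d \<noteq> 1"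
    using unit_hom_separating[OF K(1) d] by blast
  have "open (\<psi> -` B)" for B
  proof (subst open_subopen, intro ballI)
    fix x assume x: "x \<in> \<psi> -` B"
    have "\<psi> (x + k) \<in> B" if "k \<in> K" for k
      using x that \<psi> by (simp add: unit_hom_add)
    then have "coset x K \<subseteq> \<psi> -` B" by (auto simp: coset_def)
    moreover have "x \<in> coset x K" using K(1) by (simp add: mem_coset_iff is_subgroup_def)
    ultimately show "\<exists>T. open T \<and> x \<in> T \<and> T \<subseteq> \<psi> -` B" using open_coset[OF K(2)] by blast
  qed
  then have "continuous_on UNIV \<psi>" by (simp add: continuous_on_open_vimage)
  then have "is_character \<psi>" using \<psi>(1) by (simp add: is_character_def unit_hom_def)
  with \<psi> that show ?thesis by blast
qed

section \<open>Transfer to point masses\<close>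

locale haar =
  fixes M :: "'g::{topological_ab_group_add, t2_space} measure"
  assumes haar: "is_haar_measure M"
begin

lemma sets_M [measurable_cong, simp]: "sets M = sets borel"
  and space_M [simp]: "space M = UNIV"
  and emeasure_translation: "A \<in> sets borel \<Longrightarrow> emeasure M ((\<lambda>x. a + x) ` A) = emeasure M A"
  and emeasure_compact: "compact K \<Longrightarrow> emeasure M K < \<infinity>"
  and emeasure_open_pos: "open U \<Longrightarrow> U \<noteq> {} \<Longrightarrow> emeasure M U > 0"
  and outer_regular: "A \<in> sets borel \<Longrightarrow> emeasure M A = (INF U\<in>{U. open U \<and> A \<subseteq> U}. emeasure M U)"
  and inner_regular: "open U \<Longrightarrow> emeasure M U = (SUP K\<in>{K. compact K \<and> K \<subseteq> U}. emeasure M K)"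
  using haar[unfolded is_haar_measure_def] by (elim conjE; meson)+

lemma continuous_measurable: "continuous_on UNIV f \<Longrightarrow> f \<in> borel_measurable M"
  unfolding measurable_cong_sets[OF sets_M refl] by (rule borel_measurable_continuous_onI)

lemma measurable_translation: "(+) a \<in> M \<rightarrow>\<^sub>M M"
  unfolding measurable_cong_sets[OF sets_M sets_M]
  by (rule borel_measurable_continuous_onI) (intro continuous_intros)

lemma distr_translation: "distr M M ((+) a) = M"
proof (rule measure_eqI)
  fix A assume "A \<in> sets (distr M M ((+) a))"
  then have A: "A \<in> sets borel" by simp
  have "(+) a -` A = (\<lambda>x. - a + x) ` A"
    by (force simp: image_iff algebra_simps)
  moreover have "emeasure M ((\<lambda>x. - a + x) ` A) = emeasure M A"
    using A by (rule emeasure_translation)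
  ultimately show "emeasure (distr M M ((+) a)) A = emeasure M A"
    using A by (simp add: emeasure_distr[OF measurable_translation])
qed simp

lemma translation_invariance:
  fixes f :: "'g \<Rightarrow> 'b::{banach, second_countable_topology}"
  assumes "f \<in> borel_measurable M"
  shows "integrable M (\<lambda>x. f (a + x)) \<longleftrightarrow> integrable M f" "(\<integral>x. f (a + x) \<partial>M) = (\<integral>x. f x \<partial>M)"
  using integrable_distr_eq[OF measurable_translation assms] integral_distr[OF measurable_translation assms]
  by (simp_all add: distr_translation)

lemma character_measurable: "is_character \<gamma> \<Longrightarrow> \<gamma> \<in> borel_measurable M"
  by (simp add: is_character_def continuous_measurable)

lemma character_norm: "is_character \<gamma> \<Longrightarrow> cmod (\<gamma> x) = 1"
  by (simp add: is_character_def)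

lemma character_cnj: "is_character \<gamma> \<Longrightarrow> is_character (\<lambda>x. cnj (\<gamma> x))"
  unfolding is_character_def by (auto intro: continuous_on_cnj)

lemma trivial_character: "is_character (\<lambda>x::'g. 1)"
  by (simp add: is_character_def)

lemma integrable_mult_bounded:
  fixes g \<Phi> :: "'g \<Rightarrow> complex"
  assumes "integrable M g" "\<Phi> \<in> borel_measurable M" "\<And>x. cmod (\<Phi> x) \<le> 1"
  shows "integrable M (\<lambda>x. g x * \<Phi> x)"
proof (rule Bochner_Integration.integrable_bound[OF assms(1)])
  show "(\<lambda>x. g x * \<Phi> x) \<in> borel_measurable M" using assms by simp
  show "AE x in M. cmod (g x * \<Phi> x) \<le> cmod (g x)"
    using assms(3) by (simp add: norm_mult mult_left_le)
qed

text \<open>Bounds the family whose supremum is \<open>cstar_norm\<close>, so that this real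
  supremum is a genuine upper bound.\<close>

lemma norm_fourier_le:
  assumes "is_character \<gamma>"
  shows "cmod (fourier M g \<gamma>) \<le> (\<integral>x. cmod (g x) \<partial>M)"
  using integral_norm_bound[of M "\<lambda>x. g x * cnj (\<gamma> x)"] by (simp add: fourier_def norm_mult character_norm[OF assms])

lemma fourier_le_cstar_norm:
  assumes "is_character \<gamma>"
  shows "cmod (fourier M g \<gamma>) \<le> cstar_norm M g"
  unfolding cstar_norm_def
  by (rule cSUP_upper) (use assms norm_fourier_le in \<open>auto intro!: bdd_aboveI2\<close>)

lemma cstar_norm_nonneg: "0 \<le> cstar_norm M g"
  using fourier_le_cstar_norm[OF trivial_character] norm_ge_zero order_trans by blast

lemma cstar_norm_leI:
  assumes "\<And>\<gamma>. is_character \<gamma> \<Longrightarrow> cmod (fourier M g \<gamma>) \<le> B"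
  shows "cstar_norm M g \<le> B"
  unfolding cstar_norm_def by (rule cSUP_least) (use assms trivial_character in auto)

lemma le_B_norm:
  assumes "in_B M f" "integrable M g" "cstar_norm M g \<le> 1"
  shows "cmod (\<integral>x. f x * g x \<partial>M) \<le> B_norm M f"
  unfolding B_norm_def
proof (rule cSup_upper)
  obtain C where C: "\<And>g. integrable M g \<Longrightarrow> cmod (\<integral>x. f x * g x \<partial>M) \<le> C * cstar_norm M g"
    using assms(1) unfolding in_B_def by blast
  have "cmod (\<integral>x. f x * g x \<partial>M) \<le> \<bar>C\<bar>" if "integrable M g" "cstar_norm M g \<le> 1" for g
  proof -
    \<comment> \<open>The sign of \<open>C\<close> is unknown, hence the absolute value.\<close>
    have "C * cstar_norm M g \<le> \<bar>C\<bar> * 1"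
      using that cstar_norm_nonneg by (intro mult_mono) auto
    with C[OF that(1)] show ?thesis by simp
  qed
  then show "bdd_above {cmod (\<integral>x. f x * g x \<partial>M) |g. integrable M g \<and> cstar_norm M g \<le> 1}"
    by (intro bdd_aboveI[of _ "\<bar>C\<bar>"]) auto
qed (use assms in blast)

text \<open>Smears each point mass over a translate of \<open>V\<close>, so that \<open>g\<close> is
  an integrable density; by invariance its integral against \<open>h\<close> combines averages of
  \<open>h\<close> over these translates.\<close>

lemma integral_indicator_average:
  fixes h :: "'g \<Rightarrow> complex" and l :: "(real \<times> 'g) list" and m :: real
  assumes V: "V \<in> sets borel" "emeasure M V < \<infinity>"
    and h: "h \<in> borel_measurable M" "\<And>x. cmod (h x) \<le> 1"
  defines "g \<equiv> \<lambda>y. \<Sum>(c, x)\<leftarrow>l. of_real (c / m) * indicator V (y - x) :: complex"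
  shows "integrable M (\<lambda>y. g y * h y)"
    "(\<integral>y. g y * h y \<partial>M) = (\<Sum>(c, x)\<leftarrow>l. of_real (c / m) * (\<integral>y. indicator V y * h (x + y) \<partial>M))"
proof -
  have [measurable]: "h \<in> borel_measurable borel"
    using h(1) unfolding measurable_cong_sets[OF sets_M refl] .
  have trans [measurable]: "(\<lambda>y. y - x) \<in> borel \<rightarrow>\<^sub>M borel" for x :: 'g
    by (intro borel_measurable_continuous_onI continuous_intros)
  have trans' [measurable]: "(\<lambda>y. x + y) \<in> borel \<rightarrow>\<^sub>M borel" for x :: 'g
    by (intro borel_measurable_continuous_onI continuous_intros)
  note V(1) [measurable]
  have meas: "(\<lambda>y. indicator V (y - x) * h y) \<in> borel_measurable M" for x
    by measurable
  have "integrable M (\<lambda>y. indicator V y * h (x + y))" for x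
  proof (rule Bochner_Integration.integrable_bound)
    show "integrable M (indicator V :: 'g \<Rightarrow> real)" using V by simp
    show "(\<lambda>y. indicator V y * h (x + y)) \<in> borel_measurable M" by measurable
  qed (use h(2) in \<open>simp add: norm_mult indicator_def\<close>)
  then have int: "integrable M (\<lambda>y. indicator V (y - x) * h y)"
    and eq: "(\<integral>y. indicator V (y - x) * h y \<partial>M) = (\<integral>y. indicator V y * h (x + y) \<partial>M)" for x
    using translation_invariance[OF meas[of x], of x] by simp_all
  have "integrable M (\<lambda>y. g y * h y) \<and>
    (\<integral>y. g y * h y \<partial>M) = (\<Sum>(c, x)\<leftarrow>l. of_real (c / m) * (\<integral>y. indicator V y * h (x + y) \<partial>M))"
    unfolding g_def
  proof (induction l)
    case (Cons p l)
    obtain c x where p: "p = (c, x)" by fastforce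
    show ?case
      using Cons int[of x] by (simp add: p distrib_right mult.assoc eq)
  qed simp
  then show "integrable M (\<lambda>y. g y * h y)"
    "(\<integral>y. g y * h y \<partial>M) = (\<Sum>(c, x)\<leftarrow>l. of_real (c / m) * (\<integral>y. indicator V y * h (x + y) \<partial>M))" by auto
qed

lemma indicator_continuous_clopen:
  fixes S :: "'g set"
  assumes "continuous_on UNIV (indicator S :: 'g \<Rightarrow> complex)"
  shows "open S" "open (- S)"
proof -
  have "S = indicator S -` (- {0::complex})" "- S = indicator S -` (- {1::complex})"
    by (auto simp: indicator_def)
  then show "open S" "open (- S)"
    using assms by (metis open_vimage open_Compl closed_singleton)+
qed

text \<open>As \<open>S\<close> is clopen and the list finite, \<open>V\<close> can be chosen so
  small that membership in \<open>S\<close> is constant on each translate \<open>x + V\<close>. The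
  smeared test then has exactly the same value on \<open>S\<close>, without a limit.\<close>

lemma pairing_le_B_norm:
  assumes lc: "locally_compact_space (euclidean :: 'g topology)"
    and B: "in_B M (indicator S)"
    and l: "\<And>\<gamma>. unit_hom \<gamma> \<Longrightarrow> cmod (pairing l \<gamma>) \<le> 1"
  shows "cmod (pairing l (indicator S)) \<le> B_norm M (indicator S)"
proof -
  have cont: "continuous_on UNIV (indicator S :: 'g \<Rightarrow> complex)"
    using B by (simp add: in_B_def)
  note clopen = indicator_continuous_clopen[OF cont]
  have "\<exists>U K. openin euclidean U \<and> compactin euclidean K \<and> (0::'g) \<in> U \<and> U \<subseteq> K"
    using lc unfolding locally_compact_space_def by simp
  then obtain U K :: "'g set" where "openin euclidean U" "compactin euclidean K" and UK: "0 \<in> U" "U \<subseteq> K"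
    by blast
  then have UK': "open U" "compact K" by simp_all
  define W where "W x = (+) x -` (if x \<in> S then S else - S)" for x
  define V where "V = U \<inter> (\<Inter>x\<in>snd ` set l. W x)"
  have W: "open (W x)" for x
    unfolding W_def
  proof (rule open_vimage)
    show "open (if x \<in> S then S else - S)" using clopen by simp
    show "continuous_on UNIV ((+) x)" by (intro continuous_intros)
  qed
  have "open V"
    unfolding V_def by (intro open_Int UK' open_INT) (simp_all add: W)
  moreover have "0 \<in> V"
    using UK(1) by (simp add: V_def W_def)
  ultimately have V: "open V" "0 \<in> V" .
  have fin: "emeasure M V < \<infinity>"
  proof -
    have "emeasure M V \<le> emeasure M K"
      using UK UK' by (intro emeasure_mono) (auto simp: V_def compact_imp_closed)
    also have "\<dots> < \<infinity>" using UK'(2) by (rule emeasure_compact)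
    finally show ?thesis .
  qed
  define m where "m = measure M V"
  have "0 < emeasure M V" using V by (intro emeasure_open_pos) auto
  then have m: "0 < m"
    using fin by (simp add: m_def measure_def enn2real_positive_iff)
  have VM: "V \<in> sets borel" using V by simp
  have mV: "(\<integral>y. indicator V y \<partial>M) = (of_real m :: complex)"
  proof -
    have "(indicator V y :: complex) = of_real (indicator V y)" for y
      by (simp add: indicator_def)
    then have "(\<integral>y. indicator V y \<partial>M) = (\<integral>y. complex_of_real (indicator V y) \<partial>M)"
      by (simp only:)
    also have "\<dots> = of_real (\<integral>y. indicator V y \<partial>M)"
      by (rule integral_complex_of_real)
    finally show ?thesis using VM fin by (simp add: m_def)
  qed
  define g where "g y = (\<Sum>(c, x)\<leftarrow>l. of_real (c / m) * indicator V (y - x) :: complex)" for y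
  note avg = integral_indicator_average[OF VM fin, where l = l and m = m, folded g_def]
  have "integrable M g" using avg(1)[of "\<lambda>_. 1"] by simp
  moreover have "cstar_norm M g \<le> 1"
  proof (rule cstar_norm_leI)
    fix \<gamma> :: "'g \<Rightarrow> complex" assume \<gamma>: "is_character \<gamma>"
    have hom: "unit_hom (\<lambda>x. cnj (\<gamma> x))"
      using \<gamma> unfolding is_character_def unit_hom_def by simp
    \<comment> \<open>The transform of \<open>g\<close> at this character is the pairing times
      \<open>I / m\<close>, an average of unimodular values and hence of modulus at most 1.\<close>
    define I where "I = (\<integral>y. indicator V y * cnj (\<gamma> y) \<partial>M)"
    have "cmod I \<le> (\<integral>y. cmod (indicator V y * cnj (\<gamma> y)) \<partial>M)"
      unfolding I_def by (rule integral_norm_bound)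
    also have "\<dots> = (\<integral>y. indicator V y \<partial>M)"
      by (intro Bochner_Integration.integral_cong)
        (simp_all add: norm_mult character_norm[OF \<gamma>] indicator_def)
    also have "\<dots> = m"
      using VM fin by (simp add: m_def)
    finally have I: "cmod I \<le> m" .
    have "fourier M g \<gamma> = (\<Sum>(c, x)\<leftarrow>l. of_real (c / m) * (\<integral>y. indicator V y * cnj (\<gamma> (x + y)) \<partial>M))"
      unfolding fourier_def by (intro avg(2) character_measurable character_cnj \<gamma>)
        (simp add: character_norm[OF \<gamma>])
    also have "\<dots> = (\<Sum>(c, x)\<leftarrow>l. of_real c * cnj (\<gamma> x) * (I / of_real m))"
      using unit_hom_add[OF hom] by (simp add: I_def mult.left_commute[of "indicator V _"] mult.assoc)
    also have "\<dots> = pairing l (\<lambda>x. cnj (\<gamma> x)) * (I / of_real m)"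
      by (induction l) (auto simp: distrib_right add_divide_distrib)
    finally have "cmod (fourier M g \<gamma>) = cmod (pairing l (\<lambda>x. cnj (\<gamma> x))) * (cmod I / m)"
      using m by (simp add: norm_mult norm_divide)
    also have "\<dots> \<le> 1 * 1"
      using l[OF hom] I m by (intro mult_mono) auto
    finally show "cmod (fourier M g \<gamma>) \<le> 1" by simp
  qed
  ultimately have "cmod (\<integral>y. indicator S y * g y \<partial>M) \<le> B_norm M (indicator S)"
    by (rule le_B_norm[OF B])
  also have "(\<integral>y. indicator S y * g y \<partial>M) = (\<integral>y. g y * indicator S y \<partial>M)"
    by (simp add: mult.commute)
  also have "\<dots> = (\<Sum>(c, x)\<leftarrow>l. of_real (c / m) * (\<integral>y. indicator V y * indicator S (x + y) \<partial>M))"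
    by (intro avg(2) continuous_measurable[OF cont]) (simp add: indicator_def)
  also have "\<dots> = (\<Sum>(c, x)\<leftarrow>l. of_real c * indicator S x)"
  proof (intro arg_cong[of _ _ sum_list] map_cong refl, clarify)
    fix c x assume cx: "(c, x) \<in> set l"
    have "indicator V y * indicator S (x + y) = (indicator V y * indicator S x :: complex)" for y
      using cx by (force simp: V_def W_def indicator_def split: if_splits)
    then have "(\<integral>y. indicator V y * indicator S (x + y) \<partial>M) = of_real m * (indicator S x :: complex)"
      by (simp only:) (simp add: mV)
    then show "of_real (c / m) * (\<integral>y. indicator V y * indicator S (x + y) \<partial>M)
        = of_real c * (indicator S x :: complex)"
      using m by simp
  qed
  finally show ?thesis by (simp add: pairing_def)
qed

section \<open>The norm of a coset\<close>

text \<open>A class of multipliers that contains the unimodular multiples of characters and is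
  closed under products and averages; coset indicators will be approximated within it.\<close>

definition contractive :: "('g \<Rightarrow> complex) \<Rightarrow> bool" where
  "contractive \<Phi> \<longleftrightarrow> \<Phi> \<in> borel_measurable M \<and> (\<forall>x. cmod (\<Phi> x) \<le> 1) \<and>
     (\<forall>g. integrable M g \<longrightarrow> cstar_norm M (\<lambda>x. g x * \<Phi> x) \<le> cstar_norm M g)"

lemma contractiveD:
  assumes "contractive \<Phi>"
  shows "\<Phi> \<in> borel_measurable M" "cmod (\<Phi> x) \<le> 1"
    "integrable M g \<Longrightarrow> cstar_norm M (\<lambda>x. g x * \<Phi> x) \<le> cstar_norm M g"
    "integrable M g \<Longrightarrow> integrable M (\<lambda>x. g x * \<Phi> x)"
  using assms integrable_mult_bounded[of g \<Phi>] unfolding contractive_def by simp_all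

lemma contractive_one: "contractive (\<lambda>x. 1)"
  by (simp add: contractive_def)

lemma contractive_mult:
  assumes "contractive \<Phi>" "contractive \<Psi>"
  shows "contractive (\<lambda>x. \<Phi> x * \<Psi> x)"
  unfolding contractive_def
proof (intro conjI allI impI)
  show "(\<lambda>x. \<Phi> x * \<Psi> x) \<in> borel_measurable M"
    using assms contractiveD(1) by simp
  show "cmod (\<Phi> x * \<Psi> x) \<le> 1" for x
    unfolding norm_mult by (intro mult_le_one contractiveD(2) assms norm_ge_zero)
  fix g :: "'g \<Rightarrow> complex" assume g: "integrable M g"
  show "cstar_norm M (\<lambda>x. g x * (\<Phi> x * \<Psi> x)) \<le> cstar_norm M g"
    using contractiveD(3)[OF assms(2) contractiveD(4)[OF assms(1) g]] contractiveD(3)[OF assms(1) g]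
    by (simp add: mult.assoc)
qed

lemma contractive_prod:
  fixes n :: nat
  assumes "\<And>i. i < n \<Longrightarrow> contractive (\<Phi> i)"
  shows "contractive (\<lambda>x. \<Prod>i<n. \<Phi> i x)"
  using assms by (induction n) (simp_all add: contractive_one contractive_mult)

lemma contractive_character:
  assumes u: "cmod u = 1" and \<psi>: "is_character \<psi>"
  shows "contractive (\<lambda>x. u * \<psi> x)"
  unfolding contractive_def
proof (intro conjI allI impI)
  show "(\<lambda>x. u * \<psi> x) \<in> borel_measurable M"
    using character_measurable[OF \<psi>] by simp
  show "cmod (u * \<psi> x) \<le> 1" for x
    by (simp add: norm_mult u character_norm[OF \<psi>])
  fix g :: "'g \<Rightarrow> complex" assume g: "integrable M g"
  show "cstar_norm M (\<lambda>x. g x * (u * \<psi> x)) \<le> cstar_norm M g"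
  proof (rule cstar_norm_leI)
    fix \<gamma> :: "'g \<Rightarrow> complex" assume \<gamma>: "is_character \<gamma>"
    \<comment> \<open>Multiplication by a character translates the Fourier transform, which leaves
      its supremum unchanged.\<close>
    have char: "is_character (\<lambda>x. \<gamma> x * cnj (\<psi> x))"
      using \<gamma> \<psi> unfolding is_character_def by (auto simp: norm_mult intro!: continuous_intros)
    have "fourier M (\<lambda>x. g x * (u * \<psi> x)) \<gamma> = (\<integral>x. u * (g x * cnj (\<gamma> x * cnj (\<psi> x))) \<partial>M)"
      unfolding fourier_def by (intro Bochner_Integration.integral_cong) (simp_all add: ac_simps)
    also have "\<dots> = u * fourier M g (\<lambda>x. \<gamma> x * cnj (\<psi> x))"
      by (simp add: fourier_def)
    finally show "cmod (fourier M (\<lambda>x. g x * (u * \<psi> x)) \<gamma>) \<le> cstar_norm M g"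
      using fourier_le_cstar_norm[OF char, of g] by (simp add: norm_mult u)
  qed
qed

lemma contractive_average:
  fixes n :: nat
  assumes n: "0 < n" and \<Phi>: "\<And>k. k < n \<Longrightarrow> contractive (\<Phi> k)"
  shows "contractive (\<lambda>x. (\<Sum>k<n. \<Phi> k x) / of_nat n)"
  unfolding contractive_def
proof (intro conjI allI impI)
  show "(\<lambda>x. (\<Sum>k<n. \<Phi> k x) / of_nat n) \<in> borel_measurable M"
    using contractiveD(1)[OF \<Phi>] by simp
  have avg: "cmod (\<Sum>k<n. z k) / n \<le> B" if "\<And>k. k < n \<Longrightarrow> cmod (z k) \<le> B" for z B
    using sum_norm_bound[of "{..<n}" z B] that n by (simp add: divide_le_eq mult.commute)
  show "cmod ((\<Sum>k<n. \<Phi> k x) / of_nat n) \<le> 1" for x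
    using avg[of "\<lambda>k. \<Phi> k x" 1] contractiveD(2)[OF \<Phi>] by (simp add: norm_divide)
  fix g :: "'g \<Rightarrow> complex" assume g: "integrable M g"
  show "cstar_norm M (\<lambda>x. g x * ((\<Sum>k<n. \<Phi> k x) / of_nat n)) \<le> cstar_norm M g"
  proof (rule cstar_norm_leI)
    fix \<gamma> :: "'g \<Rightarrow> complex" assume \<gamma>: "is_character \<gamma>"
    have int: "integrable M (\<lambda>x. g x * \<Phi> k x * cnj (\<gamma> x))" if "k < n" for k
      by (intro integrable_mult_bounded contractiveD(4)[OF \<Phi>[OF that] g] character_measurable character_cnj \<gamma>)
        (simp add: character_norm[OF \<gamma>])
    have "fourier M (\<lambda>x. g x * ((\<Sum>k<n. \<Phi> k x) / of_nat n)) \<gamma>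
        = (\<integral>x. (\<Sum>k<n. g x * \<Phi> k x * cnj (\<gamma> x)) / of_nat n \<partial>M)"
      unfolding fourier_def by (simp add: sum_distrib_left sum_distrib_right)
    also have "\<dots> = (\<Sum>k<n. fourier M (\<lambda>x. g x * \<Phi> k x) \<gamma>) / of_nat n"
      using int by (simp add: fourier_def)
    also have "cmod \<dots> \<le> cstar_norm M g"
      unfolding norm_divide norm_of_nat
      by (intro avg order_trans[OF fourier_le_cstar_norm[OF \<gamma>] contractiveD(3)[OF \<Phi> g]])
    finally show "cmod (fourier M (\<lambda>x. g x * ((\<Sum>k<n. \<Phi> k x) / of_nat n)) \<gamma>) \<le> cstar_norm M g" .
  qed
qed

text \<open>\<open>K\<close> may have uncountably many cosets. Outer regularity encloses
  \<open>A\<close> in an open set of finite measure, which inner regularity exhausts up to a null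
  set by countably many compact sets; each of these is covered by finitely many cosets.\<close>

lemma finite_measure_countable_cosets:
  assumes K: "is_subgroup K" "open K" and A: "A \<in> sets borel" "emeasure M A < \<infinity>"
  obtains D where "countable D" "AE x in M. x \<in> A \<longrightarrow> (\<exists>d\<in>D. x \<in> coset d K)"
proof -
  have "(INF U\<in>{U. open U \<and> A \<subseteq> U}. emeasure M U) < \<infinity>"
    using A by (simp only: outer_regular[OF A(1), symmetric])
  then obtain U where U: "open U" "A \<subseteq> U" "emeasure M U < \<infinity>"
    unfolding INF_less_iff by blast
  have "{K. compact K \<and> K \<subseteq> U} \<noteq> {}" by blast
  then obtain f :: "nat \<Rightarrow> ennreal" where f: "range f \<subseteq> emeasure M ` {K. compact K \<and> K \<subseteq> U}"
    and "(SUP K\<in>{K. compact K \<and> K \<subseteq> U}. emeasure M K) = (SUP i. f i)"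
    using ennreal_SUP_countable_SUP by metis
  then have Sup: "emeasure M U = (SUP i. f i)"
    by (simp only: inner_regular[OF U(1)])
  have "\<exists>L. compact L \<and> L \<subseteq> U \<and> f i = emeasure M L" for i
    using f by blast
  then obtain L where L: "\<And>i. compact (L i)" "\<And>i. L i \<subseteq> U" "\<And>i. f i = emeasure M (L i)"
    by metis
  have LM: "L i \<in> sets borel" for i
    using L(1) by (simp add: compact_imp_closed)
  have self: "x \<in> coset x K" for x
    using K(1) by (simp add: mem_coset_iff is_subgroup_def)
  have "\<exists>D. finite D \<and> L i \<subseteq> (\<Union>d\<in>D. coset d K)" for i
  proof (rule compactE_image[OF L(1), of UNIV "\<lambda>d. coset d K" i])
    show "open (coset d K)" for d using K(2) by (rule open_coset)
    show "L i \<subseteq> (\<Union>d. coset d K)" using self by blast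
  qed blast
  then obtain D where D: "\<And>i. finite (D i)" "\<And>i. L i \<subseteq> (\<Union>d\<in>D i. coset d K)"
    by metis
  have "emeasure M (U - (\<Union>i. L i)) = emeasure M U - emeasure M (\<Union>i. L i)"
  proof (rule emeasure_Diff)
    have "emeasure M (\<Union>i. L i) \<le> emeasure M U"
      using U(1) L(2) by (intro emeasure_mono) auto
    with U(3) show "emeasure M (\<Union>i. L i) \<noteq> \<infinity>" by auto
  qed (use U(1) L(2) LM in auto)
  also have "emeasure M U \<le> emeasure M (\<Union>i. L i)"
    unfolding Sup L(3) using LM by (intro SUP_least emeasure_mono) auto
  then have "emeasure M U - emeasure M (\<Union>i. L i) = 0"
    using U(3) by (intro diff_eq_0_ennreal) simp_all
  finally have "U - (\<Union>i. L i) \<in> null_sets M"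
    using U(1) LM by (intro null_setsI) auto
  then have "AE x in M. x \<notin> U - (\<Union>i. L i)"
    by (rule AE_not_in)
  then have "AE x in M. x \<in> A \<longrightarrow> (\<exists>d\<in>(\<Union>i. D i). x \<in> coset d K)"
    by eventually_elim (use U(2) D(2) in blast)
  moreover have "countable (\<Union>i. D i)"
    using D(1) by (simp add: countable_finite)
  ultimately show ?thesis using that by blast
qed

text \<open>By Markov's inequality the countably many sets on which |g| is at least 1/(n+1) have
  finite measure, and they cover the points where \<open>g\<close> does not vanish.\<close>

lemma integrable_countable_cosets:
  fixes g :: "'g \<Rightarrow> complex"
  assumes K: "is_subgroup K" "open K" and g: "integrable M g"
  obtains d :: "nat \<Rightarrow> 'g" where "AE x in M. g x \<noteq> 0 \<longrightarrow> (\<exists>i. x \<in> coset (d i) K)"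
proof -
  define A where "A n = {x. 1 / Suc n \<le> cmod (g x)}" for n :: nat
  have gm: "g \<in> borel_measurable borel"
    using borel_measurable_integrable[OF g] unfolding measurable_cong_sets[OF sets_M refl] .
  then have A: "A n \<in> sets borel" for n
    unfolding A_def by simp
  have fin: "emeasure M (A n) < \<infinity>" for n
  proof -
    have "emeasure M {x \<in> space M. 1 / Suc n \<le> cmod (g x)} \<le> (1 / (1 / Suc n)) * (\<integral>x. cmod (g x) \<partial>M)"
      using g by (intro integral_Markov_inequality) auto
    then show ?thesis
      by (simp add: A_def order_le_less_trans[OF _ ennreal_less_top])
  qed
  have "\<exists>D. countable D \<and> (AE x in M. x \<in> A n \<longrightarrow> (\<exists>d\<in>D. x \<in> coset d K))" for n
    by (rule finite_measure_countable_cosets[OF K A fin]) blast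
  from choice[OF allI, OF this] obtain D where
    "\<forall>n. countable (D n) \<and> (AE x in M. x \<in> A n \<longrightarrow> (\<exists>d\<in>D n. x \<in> coset d K))"
    by (rule exE)
  then have D: "countable (D n)" "AE x in M. x \<in> A n \<longrightarrow> (\<exists>d\<in>D n. x \<in> coset d K)" for n
    by simp_all
  \<comment> \<open>Inserting 0 keeps the set nonempty, as its enumeration requires.\<close>
  define E where "E = insert 0 (\<Union>n. D n)"
  have E: "countable E" "E \<noteq> {}" using D(1) by (auto simp: E_def)
  have "AE x in M. \<forall>n. x \<in> A n \<longrightarrow> (\<exists>d\<in>D n. x \<in> coset d K)"
    using D(2) by (simp add: AE_all_countable)
  then have "AE x in M. g x \<noteq> 0 \<longrightarrow> (\<exists>i. x \<in> coset (from_nat_into E i) K)"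
  proof eventually_elim
    case (elim x)
    show ?case
    proof
      assume "g x \<noteq> 0"
      then obtain n where "1 / Suc n < cmod (g x)"
        using nat_approx_posE[of "cmod (g x)"] by auto
      then have "x \<in> A n" by (simp add: A_def)
      with elim obtain d where d: "d \<in> D n" "x \<in> coset d K" by blast
      then have "d \<in> E" by (auto simp: E_def)
      then obtain i where "from_nat_into E i = d" using from_nat_into_surj[OF E(1)] by blast
      with d(2) show "\<exists>i. x \<in> coset (from_nat_into E i) K" by blast
    qed
  qed
  then show ?thesis by (rule that)
qed

text \<open>The geometric sums stay below 2 / |1 - \<zeta>|, while the denominator grows.\<close>

lemma geometric_average_tendsto_0:
  fixes \<zeta> :: complex
  assumes "cmod \<zeta> = 1" "\<zeta> \<noteq> 1"
  shows "(\<lambda>n. (\<Sum>k<Suc n. \<zeta> ^ k) / of_nat (Suc n)) \<longlonglongrightarrow> 0"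
proof (rule Lim_null_comparison)
  have "cmod (\<Sum>k<m. \<zeta> ^ k) \<le> 2 / cmod (1 - \<zeta>)" for m
  proof -
    have "cmod (1 - \<zeta> ^ m) \<le> 2"
      using norm_triangle_ineq4[of 1 "\<zeta> ^ m"] assms by (simp add: norm_power)
    then show ?thesis
      using assms by (simp add: sum_gp_strict norm_divide divide_right_mono)
  qed
  then show "\<forall>\<^sub>F n in sequentially. cmod ((\<Sum>k<Suc n. \<zeta> ^ k) / of_nat (Suc n))
      \<le> 2 / cmod (1 - \<zeta>) / Suc n"
    by (intro always_eventually allI) (simp only: norm_divide norm_of_nat divide_right_mono of_nat_0_le_iff)
  show "(\<lambda>n. 2 / cmod (1 - \<zeta>) / Suc n) \<longlonglongrightarrow> 0"
    by (intro LIMSEQ_Suc[OF lim_const_over_n])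
qed

text \<open>On the countably many cosets that carry \<open>g\<close>, a suitable sequence of products of averages of
  characters converges to the indicator function of the given coset.\<close>

lemma integral_coset_le_cstar_norm:
  fixes g :: "'g \<Rightarrow> complex"
  assumes K: "is_subgroup K" "open K" and g: "integrable M g"
  shows "cmod (\<integral>x. indicator (coset c K) x * g x \<partial>M) \<le> cstar_norm M g"
proof -
  obtain d :: "nat \<Rightarrow> 'g" where d: "AE x in M. g x \<noteq> 0 \<longrightarrow> (\<exists>i. x \<in> coset (d i) K)"
    using integrable_countable_cosets[OF K g] by blast
  have "\<exists>\<psi>. is_character \<psi> \<and> (\<forall>k\<in>K. \<psi> k = 1) \<and> (d i - c \<notin> K \<longrightarrow> \<psi> (d i - c) \<noteq> 1)" for i
  proof (cases "d i - c \<in> K")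
    case True
    with trivial_character show ?thesis by (intro exI[of _ "\<lambda>x. 1"]) simp
  next
    case False
    with character_separating[OF K False] show ?thesis by metis
  qed
  then obtain \<psi> where \<psi>: "\<And>i. is_character (\<psi> i)" "\<And>i k. k \<in> K \<Longrightarrow> \<psi> i k = 1"
      "\<And>i. d i - c \<notin> K \<Longrightarrow> \<psi> i (d i - c) \<noteq> 1"
    by metis
  have hom: "unit_hom (\<psi> i)" for i
    using \<psi>(1) by (simp add: is_character_def unit_hom_def)
  \<comment> \<open>These averages equal 1 on \<open>coset c K\<close>, and tend to 0 on
    \<open>coset (d i) K\<close> when that is a different coset.\<close>
  define \<phi> where "\<phi> i n x = (\<Sum>k<Suc n. \<psi> i (x - c) ^ k) / of_nat (Suc n)" for i n x
  \<comment> \<open>The index \<open>n\<close> governs both the number of factors and the length of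
    the averages. All factors have modulus at most 1, so a single factor tending to 0
    suffices.\<close>
  define \<Phi> where "\<Phi> n x = (\<Prod>i<n. \<phi> i n x)" for n x
  have pow: "is_character (\<lambda>x. \<psi> i x ^ k)" for i k
    using \<psi>(1)[of i] unfolding is_character_def
    by (auto simp: norm_power power_mult_distrib intro!: continuous_intros)
  have "contractive (\<lambda>x. \<psi> i (x - c) ^ k)" for i k
  proof -
    have "contractive (\<lambda>x. \<psi> i (- c) ^ k * \<psi> i x ^ k)"
      by (rule contractive_character[OF _ pow]) (simp add: norm_power unit_hom_norm[OF hom])
    moreover have "\<psi> i (- c) ^ k * \<psi> i x ^ k = \<psi> i (x - c) ^ k" for x
      using unit_hom_add[OF hom, of i "- c" x] by (simp flip: power_mult_distrib)
    ultimately show ?thesis by simp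
  qed
  then have contr_\<phi>: "contractive (\<phi> i n)" for i n
    unfolding \<phi>_def by (intro contractive_average) auto
  then have contr: "contractive (\<Phi> n)" for n
    unfolding \<Phi>_def by (intro contractive_prod)
  have lim: "(\<lambda>n. \<Phi> n x) \<longlonglongrightarrow> indicator (coset c K) x" if x: "x \<in> coset (d i) K" for x i
  proof (cases "x - c \<in> K")
    case True
    have "\<phi> j n x = 1" for j n
      by (simp add: \<phi>_def \<psi>(2)[OF True] del: of_nat_Suc)
    then show ?thesis
      using True by (simp add: \<Phi>_def mem_coset_iff)
  next
    case False
    have xd: "x - d i \<in> K" using x by (simp add: mem_coset_iff)
    have "d i - c \<notin> K"
    proof
      assume dc: "d i - c \<in> K"
      have "0 - (d i - c) \<in> K" using K(1) dc unfolding is_subgroup_def by blast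
      then have "(x - d i) - (0 - (d i - c)) \<in> K" using K(1) xd unfolding is_subgroup_def by blast
      with False show False by simp
    qed
    then have ne: "\<psi> i (d i - c) \<noteq> 1" by (rule \<psi>(3))
    have "\<psi> i (x - c) = \<psi> i (x - d i) * \<psi> i (d i - c)"
      using unit_hom_add[OF hom, of i "x - d i" "d i - c"] by simp
    then have "\<psi> i (x - c) = \<psi> i (d i - c)" using \<psi>(2)[OF xd] by simp
    with ne have \<phi>0: "(\<lambda>n. \<phi> i n x) \<longlonglongrightarrow> 0"
      unfolding \<phi>_def by (intro geometric_average_tendsto_0 unit_hom_norm[OF hom]) simp
    have le: "cmod (\<Phi> n x) \<le> cmod (\<phi> i n x)" if "i < n" for n
    proof -
      have "\<Phi> n x = \<phi> i n x * (\<Prod>j\<in>{..<n} - {i}. \<phi> j n x)"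
        unfolding \<Phi>_def using that by (intro prod.remove) auto
      moreover have "cmod (\<Prod>j\<in>{..<n} - {i}. \<phi> j n x) \<le> 1"
        unfolding prod_norm[symmetric] by (intro prod_le_1 conjI norm_ge_zero contractiveD(2)[OF contr_\<phi>])
      ultimately show ?thesis by (simp add: norm_mult mult_left_le)
    qed
    have "\<forall>\<^sub>F n in sequentially. cmod (\<Phi> n x) \<le> cmod (\<phi> i n x)"
      using eventually_gt_at_top[of i] by (rule eventually_mono) (rule le)
    then have "(\<lambda>n. \<Phi> n x) \<longlonglongrightarrow> 0"
      by (rule Lim_null_comparison) (rule tendsto_norm_zero[OF \<phi>0])
    then show ?thesis using False by (simp add: mem_coset_iff)
  qed
  have "(\<lambda>n. \<integral>x. g x * \<Phi> n x \<partial>M) \<longlonglongrightarrow> (\<integral>x. indicator (coset c K) x * g x \<partial>M)"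
  proof (rule integral_dominated_convergence)
    have "(indicator (coset c K) :: 'g \<Rightarrow> complex) \<in> borel_measurable M"
      by (intro borel_measurable_indicator) (simp add: open_coset[OF K(2)])
    then show "(\<lambda>x. indicator (coset c K) x * g x) \<in> borel_measurable M"
      using g by simp
    show "(\<lambda>x. g x * \<Phi> n x) \<in> borel_measurable M" for n
      using contractiveD(4)[OF contr g] by (rule borel_measurable_integrable)
    show "integrable M (\<lambda>x. cmod (g x))" using g by simp
    show "AE x in M. (\<lambda>n. g x * \<Phi> n x) \<longlonglongrightarrow> indicator (coset c K) x * g x"
      using d
    proof eventually_elim
      case (elim x)
      show ?case
      proof (cases "g x = 0")
        case False
        with elim lim have "(\<lambda>n. \<Phi> n x) \<longlonglongrightarrow> indicator (coset c K) x" by blast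
        then show ?thesis using tendsto_mult[OF tendsto_const] by (subst mult.commute)
      qed simp
    qed
    show "AE x in M. cmod (g x * \<Phi> n x) \<le> cmod (g x)" for n
      using contractiveD(2)[OF contr] by (simp add: norm_mult mult_left_le)
  qed
  then have "(\<lambda>n. cmod (\<integral>x. g x * \<Phi> n x \<partial>M)) \<longlonglongrightarrow> cmod (\<integral>x. indicator (coset c K) x * g x \<partial>M)"
    by (rule tendsto_norm)
  \<comment> \<open>The integral is the Fourier transform at the trivial character.\<close>
  moreover have "cmod (\<integral>x. g x * \<Phi> n x \<partial>M) \<le> cstar_norm M g" for n
    using fourier_le_cstar_norm[OF trivial_character, of "\<lambda>x. g x * \<Phi> n x"] contractiveD(3)[OF contr[of n] g]
    by (simp add: fourier_def)
  ultimately show ?thesis by (intro LIMSEQ_le_const2) auto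
qed

lemma B_norm_coset_le_1:
  assumes "is_subgroup K" "open K"
  shows "B_norm M (indicator (coset c K)) \<le> 1"
  unfolding B_norm_def
proof (rule cSup_least)
  \<comment> \<open>The zero function shows that the set under the supremum is nonempty.\<close>
  have "cstar_norm M (\<lambda>x. 0) \<le> 1"
    by (rule cstar_norm_leI) (simp add: fourier_def)
  moreover have "integrable M (\<lambda>x. 0 :: complex)" by simp
  ultimately show "{cmod (\<integral>x. indicator (coset c K) x * g x \<partial>M) |g. integrable M g \<and> cstar_norm M g \<le> 1} \<noteq> {}"
    by blast
qed (use integral_coset_le_cstar_norm[OF assms] order_trans in blast)

end

theorem theorem3p3:
  fixes M :: "'g::{topological_ab_group_add, t2_space} measure"
    and S :: "'g set"
  assumes "locally_compact_space (euclidean :: 'g topology)"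
    and "is_haar_measure M"
    and "S \<noteq> {}"
    and "in_B M (indicator S :: 'g \<Rightarrow> complex)"
    and "1 < B_norm M (indicator S)"
    and "B_norm M (indicator S) < 4 / 3"
  shows "(\<exists>H a b. is_subgroup H \<and> open H \<and> S = coset a H \<union> coset b H) \<and>
         \<not> (\<exists>K c. is_subgroup K \<and> S = coset c K)"
proof -
  interpret haar M by unfold_locales fact
  interpret small_idempotent S
  proof
    fix l :: "(real \<times> 'g) list"
    assume "\<And>\<gamma>. unit_hom \<gamma> \<Longrightarrow> cmod (pairing l \<gamma>) \<le> 1"
    then have "cmod (pairing l (indicator S)) \<le> B_norm M (indicator S)"
      by (rule pairing_le_B_norm[OF assms(1,4)])
    then show "Re (pairing l (indicator S)) < 4 / 3"
      using assms(6) complex_Re_le_cmod[of "pairing l (indicator S)"] by linarith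
  qed
  have "open S"
    using assms(4) by (intro indicator_continuous_clopen(1)) (simp add: in_B_def)
  then have shift: "open {x. c + x \<in> S}" for c
    by (intro open_vimage[of S "(+) c", unfolded vimage_def] continuous_intros)
  have not_coset: "\<not> (\<exists>K c. is_subgroup K \<and> S = coset c K)"
  proof
    assume "\<exists>K c. is_subgroup K \<and> S = coset c K"
    then obtain K c where K: "is_subgroup K" "S = coset c K" by blast
    \<comment> \<open>A subgroup having \<open>S\<close> as a coset is a translate of the open set
      \<open>S\<close>, so it is open and the norm bound for cosets applies.\<close>
    then have "K = {x. c + x \<in> S}" by (simp add: mem_coset_iff)
    then have "open K" using shift by simp
    then show False using B_norm_coset_le_1[OF K(1), of c] K(2) assms(5) by simp
  qed
  from union_of_two_cosets[OF assms(3) this] obtain a b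
    where ab: "a \<in> S" "b \<in> S" "b - a \<notin> stab" and S: "S = coset a stab \<union> coset b stab" by blast
  have "open stab"
    unfolding stab_eq[OF ab] using open_Int[OF shift shift] by (simp add: Int_def)
  with is_subgroup_stab S not_coset show ?thesis by blast
qed

end
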